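(* Consider a function $\widehat{\xi}(D)=\widehat{\xi}(D;t,x,y,z)$ on digraphs, defined recursively by the following rules: \[ \widehat{\xi}(D)=t\,\widehat{\xi}(D_{-e})+y\,\widehat{\xi}(D_{/e})+z\,\widehat{\xi}(D_{\dagger e}) \text{ for an arc } e\in E(D), \] \[ \widehat{\xi}(D_1\cup D_2)=\widehat{\xi}(D_1)\widehat{\xi}(D_2) \text{ for disjoint unions},\qquad \widehat{\xi}(E_1)=x,\qquad \widehat{\xi}(E_0)=1. \] This function is well-defined, i.e. the result of applying these rules does not depend on the choice and order of the arcs to which the recurrence is applied, if and only if $t=1$ or $y=z=0$. In the latter case $\widehat{\xi}(D)=t^{|E(D)|}x^{|V(D)|}$.
   Context: Digraphs are finite directed multigraphs; loops and multiple arcs are allowed. $E_n$ is the arcless digraph on $n$ vertices. The arc operations are as follows. $D_{-e}$ deletes $e$. If $e=(u,v)$ with $u\ne v$, then $D_{/e}$ removes all arcs with tail $u$ and all arcs with head $v$ (including $e$), and then identifies $u$ and $v$ into one new vertex. If $e=(u,u)$ is a loop, then $D_{/e}$ deletes $u$ and its incident arcs. For $e=(u,v)$, $D_{\dagger e}$ deletes $u$, $v$ and all arcs incident to them.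
   Formalization: x is taken as generic (an indeterminate over an integral domain containing t, y, z, or ranging over all of that domain); for fixed values the "only if" fails, e.g. t=2, x=3, y=-3, z=0 consistently gives 3^|V(D)|. *)

theory Defs
  imports "Graph_Theory.Graph_Theory" "HOL-Computational_Algebra.Polynomial"
begin

text \<open>
  A finite directed multigraph (loops and parallel arcs allowed) is a
  \<^typ>\<open>('v, 'e) pre_digraph\<close> satisfying \<^locale>\<open>fin_digraph\<close>.
  The library's \<^locale>\<open>digraph\<close> excludes loops and parallel arcs, so it is not used here.
\<close>

text \<open>
  For a non-loop, the vertex obtained by identifying \<open>u\<close> and \<open>v\<close> is named \<open>u\<close>.
  The name is immaterial, since the recursion below is closed under isomorphism.
\<close>
definition contract_arc :: "('v, 'e) pre_digraph \<Rightarrow> 'e \<Rightarrow> ('v, 'e) pre_digraph" where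
  "contract_arc D e =
    (let u = tail D e; v = head D e; merge = (\<lambda>w. if w = v then u else w) in
     if u = v then pre_digraph.del_vert D u
     else \<lparr> verts = merge ` verts D,
            arcs = {a \<in> arcs D. tail D a \<noteq> u \<and> head D a \<noteq> v},
            tail = merge \<circ> tail D,
            head = merge \<circ> head D \<rparr>)"

definition extract_arc :: "('v, 'e) pre_digraph \<Rightarrow> 'e \<Rightarrow> ('v, 'e) pre_digraph" where
  "extract_arc D e = pre_digraph.del_vert (pre_digraph.del_vert D (tail D e)) (head D e)"

text \<open>
  \<open>xi_value t x y z D r\<close> says that \<open>r\<close> is the result of some complete application of the
  rules to \<open>D\<close>: the arc is chosen freely at each recursive step, and so is each
  decomposition into a disjoint union. Vertices and arcs are drawn from \<^typ>\<open>nat\<close>, which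
  represents every finite digraph up to isomorphism. Rule \<open>iso\<close> expresses that digraphs are
  considered up to isomorphism, so names of vertices and arcs carry no information.
  In rule \<open>disjoint_union\<close>, \<^const>\<open>compatible\<close> only says that the two operands share their
  incidence functions, as the library's \<^const>\<open>Digraph_Component.union\<close> expects. Together with
  the disjointness of the vertex sets it makes the arc sets disjoint.
\<close>
inductive xi_value ::
  "'a::comm_ring_1 \<Rightarrow> 'a \<Rightarrow> 'a \<Rightarrow> 'a \<Rightarrow> (nat, nat) pre_digraph \<Rightarrow> 'a \<Rightarrow> bool"
  for t x y z :: "'a::comm_ring_1" where
  arc: "\<lbrakk>fin_digraph D; e \<in> arcs D;
         xi_value t x y z (pre_digraph.del_arc D e) a;
         xi_value t x y z (contract_arc D e) b;
         xi_value t x y z (extract_arc D e) c\<rbrakk>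
        \<Longrightarrow> xi_value t x y z D (t * a + y * b + z * c)"
| disjoint_union: "\<lbrakk>fin_digraph D1; fin_digraph D2; compatible D1 D2; verts D1 \<inter> verts D2 = {};
         xi_value t x y z D1 a; xi_value t x y z D2 b\<rbrakk>
        \<Longrightarrow> xi_value t x y z (Digraph_Component.union D1 D2) (a * b)"
| single: "\<lbrakk>verts D = {v}; arcs D = {}\<rbrakk> \<Longrightarrow> xi_value t x y z D x"
| empty: "\<lbrakk>verts D = {}; arcs D = {}\<rbrakk> \<Longrightarrow> xi_value t x y z D 1"
| iso: "\<lbrakk>fin_digraph D; digraph_iso D D'; xi_value t x y z D a\<rbrakk> \<Longrightarrow> xi_value t x y z D' a"

definition xi_well_defined :: "'a::comm_ring_1 \<Rightarrow> 'a \<Rightarrow> 'a \<Rightarrow> 'a \<Rightarrow> bool" where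
  "xi_well_defined t x y z \<longleftrightarrow> (\<forall>D. fin_digraph D \<longrightarrow> (\<exists>!r. xi_value t x y z D r))"

text \<open>Meaningful only when \<^term>\<open>xi_well_defined t x y z\<close> and \<^term>\<open>fin_digraph D\<close>.\<close>
definition xi_hat :: "'a::comm_ring_1 \<Rightarrow> 'a \<Rightarrow> 'a \<Rightarrow> 'a \<Rightarrow> (nat, nat) pre_digraph \<Rightarrow> 'a" where
  "xi_hat t x y z D = (THE r. xi_value t x y z D r)"

text \<open>
  The variable \<open>x\<close> has to stay generic. For a fixed ring element \<open>x\<close> the characterisation
  ``\<open>t = 1\<close> or \<open>y = z = 0\<close>'' fails: with \<open>z = 0\<close> and \<open>y = (1 - t) * x\<close> the rules consistently yield
  \<open>x ^ card (verts D)\<close>. Genericity can mean that \<open>x\<close> is an indeterminate over the ring containing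
  \<open>t\<close>, \<open>y\<close>, \<open>z\<close>, i.e. the polynomial variable \<^term>\<open>[:0, 1:]\<close> with \<open>t\<close>, \<open>y\<close>, \<open>z\<close> embedded as constant
  polynomials, or that \<open>x\<close> is a function argument ranging over that ring.
\<close>

end

theory Submission
  imports Defs "HOL-Library.Multiset"
begin

text \<open>
  For \<open>t = 1\<close>, applying the recurrence to two arcs in either order gives the same result, up to
  exchanging equal summands. So eliminating the arcs one after another along a list yields a value
  that does not depend on the order of the list; it is invariant under relabelling and
  multiplicative, hence equals every result of the rules. Conversely, take a loop at \<open>u\<close> and an
  arc from \<open>u\<close> to \<open>v\<close>: starting with one or the other gives results that differ by
  \<open>(t - 1) z (x - 1)\<close>. Adding an arc from \<open>v\<close> to \<open>u\<close> changes the difference to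
  \<open>(t - 1) (y (x - (t x + y + z)) + z (x - 1))\<close>. For generic \<open>x\<close>, and already for \<open>x = 0\<close>, both
  vanish only if \<open>t = 1\<close> or \<open>y = z = 0\<close>.
\<close>

section \<open>Sequential elimination of arcs\<close>

text \<open>Arcs are given by their ends. As the arcs with head \<open>snd e\<close> disappear, only tails have to be
  renamed, and the same formula covers loops.\<close>
definition contract_ends :: "'v \<times> 'v \<Rightarrow> ('v \<times> 'v) list \<Rightarrow> ('v \<times> 'v) list" where
  "contract_ends e es =
    map (\<lambda>(p, q). (if p = snd e then fst e else p, q)) (filter (\<lambda>(p, q). p \<noteq> fst e \<and> q \<noteq> snd e) es)"

definition extract_ends :: "'v \<times> 'v \<Rightarrow> ('v \<times> 'v) list \<Rightarrow> ('v \<times> 'v) list" where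
  "extract_ends e es = filter (\<lambda>(p, q). p \<notin> {fst e, snd e} \<and> q \<notin> {fst e, snd e}) es"

lemma length_contract_ends: "length (contract_ends e es) \<le> length es"
  by (simp add: contract_ends_def)

lemma length_extract_ends: "length (extract_ends e es) \<le> length es"
  by (simp add: extract_ends_def)

text \<open>The recursion at \<open>t = 1\<close> with the arcs processed in list order. The list
  keeps multiplicities of parallel arcs, and \<open>V\<close> is carried along because isolated
  vertices leave no trace in the list. Contraction removes \<open>snd e\<close> from
  \<open>V\<close>: the merged vertex keeps the name of the tail, and for a loop this is the deleted
  vertex.\<close>

function xi_seq :: "'a::comm_ring_1 \<Rightarrow> 'a \<Rightarrow> 'a \<Rightarrow> ('v \<times> 'v) list \<Rightarrow> 'v set \<Rightarrow> 'a" where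
  "xi_seq x y z [] V = x ^ card V"
| "xi_seq x y z (e # es) V = xi_seq x y z es V
     + y * xi_seq x y z (contract_ends e es) (V - {snd e})
     + z * xi_seq x y z (extract_ends e es) (V - {fst e, snd e})"
  by pat_completeness auto
termination
  by (relation "measure (\<lambda>(x, y, z, es, V). length es)")
    (auto simp: less_Suc_eq_le length_contract_ends length_extract_ends)

section \<open>Commutation of contractions and extractions\<close>

lemma contract_ends_Cons:
  "contract_ends (u, v) ((a, b) # es) =
    (if a \<noteq> u \<and> b \<noteq> v then (if a = v then u else a, b) # contract_ends (u, v) es
     else contract_ends (u, v) es)"
  by (auto simp: contract_ends_def)

lemma extract_ends_Cons:
  "extract_ends (u, v) ((a, b) # es) =
    (if {a, b} \<inter> {u, v} = {} then (a, b) # extract_ends (u, v) es else extract_ends (u, v) es)"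
  by (auto simp: extract_ends_def)

text \<open>The assumptions say that neither arc kills the other. The second arc is met with its
  tail already renamed. In both orders exactly the arcs with tail \<open>u\<close> or
  \<open>a\<close> or with head \<open>v\<close> or \<open>b\<close> are lost, and a surviving tail
  \<open>v\<close> or \<open>b\<close> receives the name of the start of the path through
  it.\<close>

lemma contract_contract:
  assumes "a \<noteq> u" "b \<noteq> v"
  shows "contract_ends (if a = v then u else a, b) (contract_ends (u, v) es) =
    contract_ends (if u = b then a else u, v) (contract_ends (a, b) es)"
  using assms
proof (induction es)
  case (Cons f es)
  then show ?case
    by (cases f; cases "fst f = v"; cases "fst f = b")
      (auto simp: contract_ends_Cons extract_ends_Cons split: if_splits)
qed (simp add: contract_ends_def extract_ends_def)

text \<open>Renaming \<open>v\<close> to \<open>u\<close> neither creates nor destroys an incidence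
  with \<open>a\<close> or \<open>b\<close>.\<close>

lemma extract_contract_disjoint:
  assumes "{a, b} \<inter> {u, v} = {}"
  shows "extract_ends (a, b) (contract_ends (u, v) es) = contract_ends (u, v) (extract_ends (a, b) es)"
  using assms
proof (induction es)
  case (Cons f es)
  then show ?case
    by (cases f; cases "fst f = v"; cases "fst f = b")
      (auto simp: contract_ends_Cons extract_ends_Cons split: if_splits)
qed (simp add: contract_ends_def extract_ends_def)

text \<open>The two arcs form a path or a 2-cycle; in both orders precisely the arcs that avoid all
  of its vertices survive.\<close>

lemma extract_contract_adjacent:
  assumes "a \<noteq> u" "b \<noteq> v" "a = v \<or> b = u"
  shows "extract_ends (if a = v then u else a, b) (contract_ends (u, v) es) =
    extract_ends (if u = b then a else u, v) (contract_ends (a, b) es)"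
  using assms
proof (induction es)
  case (Cons f es)
  then show ?case
    by (cases f; cases "fst f = v"; cases "fst f = b")
      (auto simp: contract_ends_Cons extract_ends_Cons split: if_splits)
qed (simp add: contract_ends_def extract_ends_def)

lemma extract_extract:
  "extract_ends e (extract_ends f es) = extract_ends f (extract_ends e es)"
  by (induction es) (auto simp: extract_ends_def)

text \<open>Two arcs interact only if they share a tail or a head, in which case each kills the other, or
  if they are consecutive, in which case every further operation acts on the path they form.\<close>
lemma xi_seq_swap: "xi_seq x y z (e # f # es) V = xi_seq x y z (f # e # es) V"
proof -
  obtain u v a b where e: "e = (u, v)" and f: "f = (a, b)" by (cases e, cases f) auto
  consider (kill) "a = u \<or> b = v" | (disj) "{a, b} \<inter> {u, v} = {}"
    | (adj) "a \<noteq> u" "b \<noteq> v" "a = v \<or> b = u" by auto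
  then show ?thesis
  proof cases
    case kill
    \<comment> \<open>Each arc disappears when the other is contracted or extracted, so both orders
      yield the value of \<open>es\<close> plus the same four terms, two for each arc.\<close>
    then have "contract_ends e (f # es) = contract_ends e es" "contract_ends f (e # es) = contract_ends f es"
      "extract_ends e (f # es) = extract_ends e es" "extract_ends f (e # es) = extract_ends f es"
      unfolding e f by (auto simp: contract_ends_def extract_ends_def)
    then show ?thesis by (simp add: algebra_simps)
  next
    case disj
    then have d: "{u, v} \<inter> {a, b} = {}" "a \<noteq> u" "b \<noteq> v" "a \<noteq> v" "u \<noteq> b" by auto
    \<comment> \<open>Here every mixed term is matched with the one performing the same two
      operations in the other order.\<close>
    have V: "V - {v} - {b} = V - {b} - {v}" "V - {v} - {a, b} = V - {a, b} - {v}"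
      "V - {b} - {u, v} = V - {u, v} - {b}" "V - {u, v} - {a, b} = V - {a, b} - {u, v}" by auto
    have c: "contract_ends (u, v) ((a, b) # es) = (a, b) # contract_ends (u, v) es"
      "contract_ends (a, b) ((u, v) # es) = (u, v) # contract_ends (a, b) es"
      "extract_ends (u, v) ((a, b) # es) = (a, b) # extract_ends (u, v) es"
      "extract_ends (a, b) ((u, v) # es) = (u, v) # extract_ends (a, b) es"
      using disj d by (simp_all add: contract_ends_Cons extract_ends_Cons)
    have cc: "contract_ends (a, b) (contract_ends (u, v) es) = contract_ends (u, v) (contract_ends (a, b) es)"
      using contract_contract[of a u b v es] d by simp
    show ?thesis unfolding e f
      by (simp only: xi_seq.simps c cc extract_contract_disjoint[OF disj]
          extract_contract_disjoint[OF d(1)] extract_extract[of "(a, b)" "(u, v)"] fst_conv snd_conv V)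
        (simp add: algebra_simps)
  next
    case adj
    \<comment> \<open>\<open>a'\<close> is the tail of \<open>f\<close> after contracting
      \<open>e\<close>, and \<open>u'\<close> the tail of \<open>e\<close> after contracting
      \<open>f\<close>. Extraction kills the other arc, so the only mixed terms are contraction
      followed by extraction. They match each other with the roles of \<open>e\<close> and
      \<open>f\<close> exchanged.\<close>
    define a' where "a' = (if a = v then u else a)"
    define u' where "u' = (if u = b then a else u)"
    have ne: "{a, b} \<inter> {u, v} \<noteq> {}" "{u, v} \<inter> {a, b} \<noteq> {}" using adj by auto
    have V: "V - {v} - {b} = V - {b} - {v}" "V - {v} - {a', b} = V - {b} - {u', v}"
      using adj by (auto simp: a'_def u'_def)
    have ce: "contract_ends (u, v) ((a, b) # es) = (a', b) # contract_ends (u, v) es"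
      using adj by (simp add: contract_ends_Cons a'_def)
    have cf: "contract_ends (a, b) ((u, v) # es) = (u', v) # contract_ends (a, b) es"
      using adj by (auto simp add: contract_ends_Cons u'_def)
    have xe: "extract_ends (u, v) ((a, b) # es) = extract_ends (u, v) es"
      "extract_ends (a, b) ((u, v) # es) = extract_ends (a, b) es"
      using ne by (simp_all add: extract_ends_Cons)
    have cc: "contract_ends (a', b) (contract_ends (u, v) es) = contract_ends (u', v) (contract_ends (a, b) es)"
      unfolding a'_def u'_def by (rule contract_contract[OF adj(1,2)])
    have xc: "extract_ends (a', b) (contract_ends (u, v) es) = extract_ends (u', v) (contract_ends (a, b) es)"
      unfolding a'_def u'_def by (rule extract_contract_adjacent[OF adj])
    show ?thesis unfolding e f
      by (simp only: xi_seq.simps ce cf xe cc xc fst_conv snd_conv V) (simp add: algebra_simps)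
  qed
qed

section \<open>Independence of the order of the arcs\<close>

lemma mset_contract_ends_cong:
  "mset es = mset es' \<Longrightarrow> mset (contract_ends e es) = mset (contract_ends e es')"
  by (simp add: contract_ends_def)

lemma mset_extract_ends_cong:
  "mset es = mset es' \<Longrightarrow> mset (extract_ends e es) = mset (extract_ends e es')"
  by (simp add: extract_ends_def)

lemma xi_seq_cong_mset:
  "mset es = mset es' \<Longrightarrow> xi_seq x y z es V = xi_seq x y z es' V"
proof (induction "length es" arbitrary: es es' V rule: less_induct)
  case less
  \<comment> \<open>Below a common first arc, contraction and extraction respect equality of
    multisets and do not lengthen the list, so the induction hypothesis applies to all three
    branches.\<close>
  have Cons_cong: "xi_seq x y z (e # es1) V = xi_seq x y z (e # es2) V"
    if "mset es1 = mset es2" "length es1 < length es" for e es1 es2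
  proof -
    have "xi_seq x y z (contract_ends e es1) W = xi_seq x y z (contract_ends e es2) W"
      "xi_seq x y z (extract_ends e es1) W = xi_seq x y z (extract_ends e es2) W" for W
      using that by (intro less.hyps mset_contract_ends_cong mset_extract_ends_cong
          le_less_trans[OF length_contract_ends] le_less_trans[OF length_extract_ends]; simp)+
    then show ?thesis using less.hyps[OF that(2,1)] by simp
  qed
  show ?case
  proof (cases es)
    case Nil
    then show ?thesis using less.prems by simp
  next
    case (Cons e es1)
    with less.prems obtain f es2 where es': "es' = f # es2" by (cases es') auto
    show ?thesis
    proof (cases "e = f")
      case True
      then show ?thesis using Cons_cong[of es1 es2 e] less.prems Cons es' by simp
    next
      case False
      have "add_mset e (mset es1) = add_mset f (mset es2)" using less.prems Cons es' by simp
      \<comment> \<open>\<open>K\<close> holds the arcs other than one copy each of \<open>e\<close>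
        and \<open>f\<close>. Both tails can then be reordered so that the lists start with these
        two arcs, and one swap connects them.\<close>
      then obtain K where K: "mset es1 = add_mset f K" "mset es2 = add_mset e K"
        using False by (auto simp: add_eq_conv_ex)
      obtain r where r: "mset r = K" using ex_mset by blast
      have len: "length es1 < length es" "length es2 < length es"
        using Cons es' less.prems mset_eq_length[OF less.prems] by simp_all
      have "xi_seq x y z (e # es1) V = xi_seq x y z (e # f # r) V"
        using K r len by (intro Cons_cong) auto
      also have "\<dots> = xi_seq x y z (f # e # r) V" by (rule xi_seq_swap)
      also have "\<dots> = xi_seq x y z (f # es2) V"
        using K r len mset_eq_length[of es2 "e # r"] by (intro Cons_cong) auto
      finally show ?thesis using Cons es' by simp
    qed
  qed
qed

section \<open>Relabelling and disjoint unions\<close>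

lemma set_contract_ends: "set es \<subseteq> V \<times> V \<Longrightarrow> e \<in> V \<times> V \<Longrightarrow>
    set (contract_ends e es) \<subseteq> (V - {snd e}) \<times> (V - {snd e})"
  by (auto simp: contract_ends_def split: if_splits)

lemma set_extract_ends: "set es \<subseteq> V \<times> V \<Longrightarrow>
    set (extract_ends e es) \<subseteq> (V - {fst e, snd e}) \<times> (V - {fst e, snd e})"
  by (auto simp: extract_ends_def)

text \<open>The operations only test vertices of \<open>V\<close> for equality and introduce no new
  ones, so injectivity on \<open>V\<close> is enough.\<close>

lemma xi_seq_map_inj:
  assumes "inj_on \<phi> V" "set es \<subseteq> V \<times> V"
  shows "xi_seq x y z (map (map_prod \<phi> \<phi>) es) (\<phi> ` V) = xi_seq x y z es V"
  using assms
proof (induction x y z es V rule: xi_seq.induct)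
  case (1 x y z V)
  then show ?case by (simp add: card_image)
next
  case (2 x y z e es V)
  obtain u v where e: "e = (u, v)" by fastforce
  have uv: "u \<in> V" "v \<in> V" and es: "set es \<subseteq> V \<times> V" using 2 e by auto
  have eq: "\<phi> p = \<phi> q \<longleftrightarrow> p = q" if "p \<in> V" "q \<in> V" for p q
    using 2(4) that by (auto dest: inj_onD)
  have c: "contract_ends (map_prod \<phi> \<phi> e) (map (map_prod \<phi> \<phi>) es) = map (map_prod \<phi> \<phi>) (contract_ends e es)"
    using es uv unfolding e by (induction es) (auto simp: contract_ends_Cons contract_ends_def eq)
  have x: "extract_ends (map_prod \<phi> \<phi> e) (map (map_prod \<phi> \<phi>) es) = map (map_prod \<phi> \<phi>) (extract_ends e es)"
    using es uv unfolding e by (induction es) (auto simp: extract_ends_def eq)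
  have V: "\<phi> ` V - {\<phi> v} = \<phi> ` (V - {v})" "\<phi> ` V - {\<phi> u, \<phi> v} = \<phi> ` (V - {u, v})"
    using uv by (auto simp: eq)
  have "set (contract_ends e es) \<subseteq> (V - {snd e}) \<times> (V - {snd e})"
    using es uv by (intro set_contract_ends) (auto simp: e)
  moreover have "set (extract_ends e es) \<subseteq> (V - {fst e, snd e}) \<times> (V - {fst e, snd e})"
    using es by (rule set_extract_ends)
  moreover have "inj_on \<phi> (V - A)" for A using 2(4) by (rule inj_on_diff)
  ultimately show ?case using 2(1-3) 2(4) es c x V by (simp add: e)
qed

lemma contract_ends_append: "contract_ends e (es @ fs) = contract_ends e es @ contract_ends e fs"
  by (simp add: contract_ends_def)

lemma extract_ends_append: "extract_ends e (es @ fs) = extract_ends e es @ extract_ends e fs"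
  by (simp add: extract_ends_def)

lemma contract_ends_id:
  assumes "e \<in> V \<times> V" "set es \<subseteq> W \<times> W" "V \<inter> W = {}"
  shows "contract_ends e es = es"
  using assms by (induction es) (auto simp: contract_ends_def)

lemma extract_ends_id:
  assumes "e \<in> V \<times> V" "set es \<subseteq> W \<times> W" "V \<inter> W = {}"
  shows "extract_ends e es = es"
  using assms by (induction es) (auto simp: extract_ends_def)

text \<open>Operating on an arc inside \<open>V\<close> leaves all arcs inside \<open>W\<close>
  unchanged, so each branch of the recursion on \<open>es\<close> carries the same factor.\<close>

lemma xi_seq_append:
  assumes "finite V" "finite W" "V \<inter> W = {}" "set es \<subseteq> V \<times> V" "set fs \<subseteq> W \<times> W"
  shows "xi_seq x y z (es @ fs) (V \<union> W) = xi_seq x y z es V * xi_seq x y z fs W"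
  using assms
proof (induction x y z es V rule: xi_seq.induct)
  case (1 x y z V)
  \<comment> \<open>Once \<open>es\<close> is exhausted, \<open>V\<close> consists of isolated
    vertices; a second induction, along \<open>fs\<close>, pulls out their contribution.\<close>
  have "xi_seq x y z fs (V \<union> W) = x ^ card V * xi_seq x y z fs W"
    using 1(5,1,2,3)
  proof (induction x y z fs W rule: xi_seq.induct)
    case (1 x y z W)
    then show ?case by (simp add: card_Un_disjoint power_add)
  next
    case (2 x y z e es W)
    have e: "e \<in> W \<times> W" and es: "set es \<subseteq> W \<times> W" using 2(4) by auto
    have V: "V \<union> W - {snd e} = V \<union> (W - {snd e})"
      "V \<union> W - {fst e, snd e} = V \<union> (W - {fst e, snd e})" using e 2(7) by auto
    show ?case
      using 2(1)[OF es] 2(2)[OF set_contract_ends[OF es e]] 2(3)[OF set_extract_ends[OF es]] 2(5-7)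
      by (simp add: V Int_Diff Diff_Int_distrib algebra_simps)
  qed
  then show ?case by simp
next
  case (2 x y z e es V)
  have e: "e \<in> V \<times> V" and es: "set es \<subseteq> V \<times> V" using 2(7) by auto
  have V: "V \<union> W - {snd e} = (V - {snd e}) \<union> W"
    "V \<union> W - {fst e, snd e} = (V - {fst e, snd e}) \<union> W" using e 2(6) by auto
  have d: "(V - A) \<inter> W = {}" for A using 2(6) by auto
  show ?case
    using 2(1)[OF 2(4-6) es 2(8)]
      2(2)[OF _ 2(5) d set_contract_ends[OF es e] 2(8)]
      2(3)[OF _ 2(5) d set_extract_ends[OF es] 2(8)] 2(4)
    by (simp add: V contract_ends_append extract_ends_append algebra_simps
        contract_ends_id[OF e 2(8,6)] extract_ends_id[OF e 2(8,6)])
qed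

section \<open>Digraph operations\<close>

lemma fin_digraph_contract_arc:
  assumes "fin_digraph D" "e \<in> arcs D"
  shows "fin_digraph (contract_arc D e)"
proof -
  interpret fin_digraph D by fact
  show ?thesis
  proof (cases "tail D e = head D e")
    case True
    then show ?thesis by (simp add: contract_arc_def Let_def fin_digraph_del_vert)
  next
    case False
    then show ?thesis using assms(2)
      by unfold_locales (auto simp: contract_arc_def Let_def)
  qed
qed

lemma fin_digraph_extract_arc:
  assumes "fin_digraph D" shows "fin_digraph (extract_arc D e)"
  unfolding extract_arc_def using assms by (intro fin_digraph.fin_digraph_del_vert)

lemma fin_digraph_union:
  assumes "fin_digraph D1" "fin_digraph D2" "compatible D1 D2"
  shows "fin_digraph (Digraph_Component.union D1 D2)"
proof -
  interpret D1: fin_digraph D1 by fact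
  interpret D2: fin_digraph D2 by fact
  show ?thesis using assms(3) D1.wellformed D2.wellformed
    by unfold_locales (fastforce simp: compatible_def)+
qed

lemma fin_digraph_iso:
  assumes "fin_digraph D" "digraph_iso D D'" shows "fin_digraph D'"
proof -
  interpret fin_digraph D by fact
  obtain h where h: "digraph_isomorphism h" "D' = app_iso h D"
    using assms(2) by (auto simp: digraph_iso_def)
  show ?thesis using h(1) unfolding h(2)
    by unfold_locales (auto simp: iso_verts_tail iso_verts_head)
qed

lemma fin_digraph_arcless:
  assumes "finite (verts D)" "arcs D = {}" shows "fin_digraph D"
  using assms by unfold_locales auto

text \<open>As compatible digraphs share the tail function, a common arc would have its tail in both
  vertex sets.\<close>

lemma arcs_disjoint:
  assumes "fin_digraph D1" "fin_digraph D2" "compatible D1 D2" "verts D1 \<inter> verts D2 = {}"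
  shows "arcs D1 \<inter> arcs D2 = {}"
proof -
  have "tail D1 e \<in> verts D1 \<inter> verts D2" if "e \<in> arcs D1" "e \<in> arcs D2" for e
    using that assms wf_digraph.tail_in_verts[OF fin_digraph.axioms(1), of D1 e]
      wf_digraph.tail_in_verts[OF fin_digraph.axioms(1), of D2 e]
    by (auto simp: compatible_def)
  then show ?thesis using assms(4) by blast
qed

lemma verts_contract_arc:
  assumes "fin_digraph D" "e \<in> arcs D"
  shows "verts (contract_arc D e) = verts D - {head D e}"
proof -
  interpret fin_digraph D by fact
  show ?thesis using assms(2) by (auto simp: contract_arc_def Let_def verts_del_vert)
qed

lemma arcs_contract_arc:
  "arcs (contract_arc D e) = {a \<in> arcs D. tail D a \<noteq> tail D e \<and> head D a \<noteq> head D e}"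
  by (auto simp: contract_arc_def Let_def pre_digraph.arcs_del_vert)

text \<open>No surviving arc has the contracted head as its head, so merging can affect tails only;
  for a loop it affects nothing.\<close>

lemma ends_contract_arc:
  assumes "a \<in> arcs (contract_arc D e)"
  shows "arc_to_ends (contract_arc D e) a =
    (if tail D a = head D e then tail D e else tail D a, head D a)"
  using assms[unfolded arcs_contract_arc]
  by (auto simp: arc_to_ends_def contract_arc_def Let_def
      pre_digraph.tail_del_vert pre_digraph.head_del_vert)

lemma verts_extract_arc: "verts (extract_arc D e) = verts D - {tail D e, head D e}"
  by (auto simp: extract_arc_def pre_digraph.verts_del_vert)

lemma arcs_extract_arc: "arcs (extract_arc D e) =
    {a \<in> arcs D. tail D a \<notin> {tail D e, head D e} \<and> head D a \<notin> {tail D e, head D e}}"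
  by (auto simp: extract_arc_def pre_digraph.arcs_del_vert pre_digraph.tail_del_vert
      pre_digraph.head_del_vert)

lemma ends_extract_arc: "arc_to_ends (extract_arc D e) = arc_to_ends D"
  by (auto simp: extract_arc_def arc_to_ends_def pre_digraph.tail_del_vert pre_digraph.head_del_vert)

lemma ends_del_arc: "arc_to_ends (pre_digraph.del_arc D e) = arc_to_ends D"
  by (auto simp: arc_to_ends_def pre_digraph.del_arc_simps)

text \<open>The bridge to \<open>xi_seq\<close>: arc names are forgotten and multiplicities kept.
  Any list with this multiset represents the arcs of \<open>D\<close>.\<close>

definition ends_mset :: "('v, 'e) pre_digraph \<Rightarrow> ('v \<times> 'v) multiset" where
  "ends_mset D = image_mset (arc_to_ends D) (mset_set (arcs D))"

lemma ends_mset_del_arc: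
  assumes "fin_digraph D" "e \<in> arcs D"
  shows "ends_mset D = add_mset (arc_to_ends D e) (ends_mset (pre_digraph.del_arc D e))"
proof -
  interpret fin_digraph D by fact
  show ?thesis
    using mset_set.remove[OF finite_arcs assms(2)]
    by (simp add: ends_mset_def ends_del_arc)
qed

lemma ends_mset_contract_arc:
  assumes "fin_digraph D" "e \<in> arcs D" "mset es = ends_mset (pre_digraph.del_arc D e)"
  shows "mset (contract_ends (arc_to_ends D e) es) = ends_mset (contract_arc D e)"
proof -
  interpret fin_digraph D by fact
  \<comment> \<open>The arc \<open>e\<close> itself does not survive, so it may be removed
    beforehand, which leaves the arcs listed in \<open>es\<close>.\<close>
  have "arcs (contract_arc D e) =
      {a \<in> arcs D - {e}. tail D a \<noteq> tail D e \<and> head D a \<noteq> head D e}"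
    by (auto simp: arcs_contract_arc)
  then have "mset_set (arcs (contract_arc D e)) =
      filter_mset (\<lambda>a. tail D a \<noteq> tail D e \<and> head D a \<noteq> head D e) (mset_set (arcs D - {e}))"
    by (simp add: filter_mset_mset_set)
  moreover have "ends_mset (contract_arc D e) =
      image_mset (\<lambda>a. (if tail D a = head D e then tail D e else tail D a, head D a))
        (mset_set (arcs (contract_arc D e)))"
    unfolding ends_mset_def
    by (intro image_mset_cong ends_contract_arc) (simp add: arcs_contract_arc)
  ultimately show ?thesis
    by (simp add: contract_ends_def assms(3) ends_mset_def filter_mset_image_mset ends_del_arc
        arc_to_ends_def[of D] multiset.map_comp comp_def cong: if_cong)
qed

lemma ends_mset_extract_arc:
  assumes "fin_digraph D" "e \<in> arcs D" "mset es = ends_mset (pre_digraph.del_arc D e)"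
  shows "mset (extract_ends (arc_to_ends D e) es) = ends_mset (extract_arc D e)"
proof -
  interpret fin_digraph D by fact
  have "arcs (extract_arc D e) =
      {a \<in> arcs D - {e}. tail D a \<notin> {tail D e, head D e} \<and> head D a \<notin> {tail D e, head D e}}"
    by (auto simp: arcs_extract_arc)
  then have "mset_set (arcs (extract_arc D e)) = filter_mset
      (\<lambda>a. tail D a \<notin> {tail D e, head D e} \<and> head D a \<notin> {tail D e, head D e}) (mset_set (arcs D - {e}))"
    by (simp add: filter_mset_mset_set)
  then show ?thesis
    by (simp add: extract_ends_def assms(3) ends_mset_def filter_mset_image_mset ends_del_arc
        ends_extract_arc arc_to_ends_def[of D] comp_def)
qed

lemma set_ends_mset:
  assumes "fin_digraph D" "mset es = ends_mset D"
  shows "set es \<subseteq> verts D \<times> verts D"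
proof -
  interpret fin_digraph D by fact
  have "set es = arc_to_ends D ` arcs D"
    using arg_cong[OF assms(2), of set_mset] by (simp add: ends_mset_def)
  then show ?thesis by (auto simp: arc_to_ends_def)
qed

section \<open>Values of the recursion\<close>

lemma xi_value_fin_digraph: "xi_value t x y z D r \<Longrightarrow> fin_digraph D"
  by (induction rule: xi_value.induct)
    (auto intro: fin_digraph_union fin_digraph_iso fin_digraph_arcless)

text \<open>Each rule corresponds to a property of \<open>xi_seq\<close>: the freely chosen arc can
  be moved to the front of the list, disjoint unions multiply by \<open>xi_seq_append\<close>, and
  isomorphisms are injective relabellings. The right-hand side does not depend on the derivation,
  which gives uniqueness.\<close>

lemma xi_value_t_1:
  assumes "xi_value 1 x y z D r" "mset es = ends_mset D"
  shows "r = xi_seq x y z es (verts D)"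
  using assms
proof (induction arbitrary: es rule: xi_value.induct)
  case (arc D e a b c)
  obtain fs where fs: "mset fs = ends_mset (pre_digraph.del_arc D e)" using ex_mset by blast
  let ?e = "arc_to_ends D e"
  have "mset es = mset (?e # fs)"
    using arc.prems ends_mset_del_arc[OF arc.hyps(1,2)] fs by simp
  then have "xi_seq x y z es (verts D) = xi_seq x y z (?e # fs) (verts D)"
    by (rule xi_seq_cong_mset)
  also have "\<dots> = a + y * b + z * c"
    using arc.IH(1)[OF fs] arc.IH(2)[OF ends_mset_contract_arc[OF arc.hyps(1,2) fs]]
      arc.IH(3)[OF ends_mset_extract_arc[OF arc.hyps(1,2) fs]]
    by (simp add: verts_contract_arc[OF arc.hyps(1,2)] verts_extract_arc arc_to_ends_def
        pre_digraph.verts_del_arc)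
  finally show ?case by simp
next
  case (disjoint_union D1 D2 a b)
  obtain fs gs where fs: "mset fs = ends_mset D1" and gs: "mset gs = ends_mset D2"
    using ex_mset by metis
  have fin: "finite (verts D1)" "finite (verts D2)" "finite (arcs D1)" "finite (arcs D2)"
    using disjoint_union.hyps(1,2) by (auto simp: fin_digraph_def fin_digraph_axioms_def)
  have ends: "arc_to_ends (Digraph_Component.union D1 D2) = arc_to_ends D1"
    "arc_to_ends D2 = arc_to_ends D1"
    using disjoint_union.hyps(3) by (auto simp: arc_to_ends_def compatible_def)
  have "mset es = mset (fs @ gs)"
    using disjoint_union.prems fin arcs_disjoint[OF disjoint_union.hyps(1-4)]
    by (simp add: fs gs ends_mset_def mset_set_Union ends)
  then have "xi_seq x y z es (verts D1 \<union> verts D2) = xi_seq x y z (fs @ gs) (verts D1 \<union> verts D2)"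
    by (rule xi_seq_cong_mset)
  also have "\<dots> = a * b"
    using disjoint_union.IH(1)[OF fs] disjoint_union.IH(2)[OF gs]
      xi_seq_append[OF fin(1,2) disjoint_union.hyps(4) set_ends_mset[OF disjoint_union.hyps(1) fs]
        set_ends_mset[OF disjoint_union.hyps(2) gs]]
    by simp
  finally show ?case by simp
next
  case (single D v)
  then show ?case by (simp add: ends_mset_def)
next
  case (empty D)
  then show ?case by (simp add: ends_mset_def)
next
  case (iso D D' a)
  interpret fin_digraph D by fact
  obtain h where h: "digraph_isomorphism h" "D' = app_iso h D"
    using iso.hyps(2) by (auto simp: digraph_iso_def)
  obtain fs where fs: "mset fs = ends_mset D" using ex_mset by blast
  have inj: "inj_on (iso_verts h) (verts D)" "inj_on (iso_arcs h) (arcs D)"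
    using h(1) by (auto simp: digraph_isomorphism_def)
  have "mset es = ends_mset D'" by fact
  also have "\<dots> = image_mset (\<lambda>a. arc_to_ends D' (iso_arcs h a)) (mset_set (arcs D))"
    by (simp add: h(2) ends_mset_def image_mset_mset_set[OF inj(2), symmetric] multiset.map_comp comp_def)
  also have "\<dots> = image_mset (\<lambda>a. map_prod (iso_verts h) (iso_verts h) (arc_to_ends D a)) (mset_set (arcs D))"
    by (intro image_mset_cong) (simp add: arc_to_ends_def h iso_verts_tail iso_verts_head)
  also have "\<dots> = mset (map (map_prod (iso_verts h) (iso_verts h)) fs)"
    by (simp add: fs ends_mset_def multiset.map_comp comp_def)
  finally have "xi_seq x y z es (verts D') =
      xi_seq x y z (map (map_prod (iso_verts h) (iso_verts h)) fs) (iso_verts h ` verts D)"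
    by (simp add: h(2) xi_seq_cong_mset)
  also have "\<dots> = a"
    using xi_seq_map_inj[OF inj(1) set_ends_mset[OF iso.hyps(1) fs]] iso.IH[OF fs] by simp
  finally show ?case by simp
qed

text \<open>Only the deletion branch contributes, with a factor \<open>t\<close> per arc; both
  cardinalities are additive over disjoint unions and invariant under isomorphism.\<close>

lemma xi_value_y_z_0:
  "xi_value t x 0 0 D r \<Longrightarrow> r = t ^ card (arcs D) * x ^ card (verts D)"
proof (induction rule: xi_value.induct)
  case (arc D e a b c)
  interpret fin_digraph D by fact
  have "card (arcs D) = Suc (card (arcs D - {e}))"
    using arc.hyps(2) card.remove[OF finite_arcs] by blast
  then show ?case using arc.IH(1) by simp
next
  case (disjoint_union D1 D2 a b)
  have "finite (verts D1)" "finite (verts D2)" "finite (arcs D1)" "finite (arcs D2)"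
    using disjoint_union.hyps(1,2) by (auto simp: fin_digraph_def fin_digraph_axioms_def)
  then show ?case
    using disjoint_union.IH disjoint_union.hyps(4) arcs_disjoint[OF disjoint_union.hyps(1-4)]
    by (simp add: card_Un_disjoint power_add)
next
  case (iso D D' a)
  then show ?case
    by (auto simp: digraph_iso_def pre_digraph.digraph_isomorphism_def card_image)
qed simp_all

section \<open>Existence of a value\<close>

lemma xi_value_arcless:
  assumes "finite (verts D)" "arcs D = {}"
  shows "xi_value t x y z D (x ^ card (verts D))"
  using assms
proof (induction "card (verts D)" arbitrary: D)
  case 0
  then show ?case using xi_value.empty[of D] by simp
next
  case (Suc n)
  then obtain v where v: "v \<in> verts D" by fastforce
  \<comment> \<open>Only the vertex sets are changed, so the parts share the incidence functions of
    \<open>D\<close> and their union is literally \<open>D\<close>.\<close>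
  let ?D1 = "D\<lparr>verts := {v}\<rparr>" and ?D2 = "D\<lparr>verts := verts D - {v}\<rparr>"
  have n: "card (verts ?D2) = n" using Suc v by simp
  have "xi_value t x y z (Digraph_Component.union ?D1 ?D2) (x * x ^ n)"
  proof (rule xi_value.disjoint_union)
    show "fin_digraph ?D1" "fin_digraph ?D2"
      using Suc.prems by (auto intro: fin_digraph_arcless)
    show "compatible ?D1 ?D2" by (simp add: compatible_def)
    show "xi_value t x y z ?D1 x" using Suc.prems by (intro xi_value.single) auto
    show "xi_value t x y z ?D2 (x ^ n)" using Suc.hyps(1)[of ?D2] n Suc.prems by simp
  qed auto
  moreover have "Digraph_Component.union ?D1 ?D2 = D"
    using v by (intro pre_digraph.equality) auto
  ultimately show ?case using Suc(2) by (metis power_Suc)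
qed

lemma xi_value_exists: "fin_digraph D \<Longrightarrow> \<exists>r. xi_value t x y z D r"
proof (induction "card (arcs D)" arbitrary: D rule: less_induct)
  case less
  interpret fin_digraph D by fact
  show ?case
  proof (cases "arcs D = {}")
    case True
    then show ?thesis using xi_value_arcless[OF finite_verts] by blast
  next
    case False
    then obtain e where e: "e \<in> arcs D" by blast
    \<comment> \<open>All three digraphs in the recurrence lack \<open>e\<close>, so each has fewer
      arcs than \<open>D\<close>.\<close>
    have "\<exists>r. xi_value t x y z D' r" if "fin_digraph D'" "arcs D' \<subseteq> arcs D - {e}" for D'
      using that e by (intro less.hyps psubset_card_mono) auto
    moreover have "arcs (contract_arc D e) \<subseteq> arcs D - {e}" "arcs (extract_arc D e) \<subseteq> arcs D - {e}"
      by (auto simp: arcs_contract_arc arcs_extract_arc)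
    ultimately obtain a b c where "xi_value t x y z (del_arc e) a"
      "xi_value t x y z (contract_arc D e) b" "xi_value t x y z (extract_arc D e) c"
      using fin_digraph_del_arc fin_digraph_contract_arc[OF less.prems e]
        fin_digraph_extract_arc[OF less.prems] by (metis arcs_del_arc order_refl)
    then show ?thesis using xi_value.arc[OF less.prems e] by blast
  qed
qed

section \<open>Two conflicting digraphs\<close>

lemma xi_value_arcI:
  assumes "fin_digraph D" "e \<in> arcs D" "xi_value t x y z (pre_digraph.del_arc D e) a"
    "xi_value t x y z (contract_arc D e) b" "xi_value t x y z (extract_arc D e) c"
    "r = t * a + y * b + z * c"
  shows "xi_value t x y z D r"
  using xi_value.arc[OF assms(1-5)] assms(6) by simp

lemma xi_value_loop:
  assumes "verts D = {u}" "arcs D = {e}" "arc_to_ends D e = (u, u)"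
  shows "xi_value t x y z D (t * x + y + z)"
proof (rule xi_value_arcI)
  show "fin_digraph D" using assms by unfold_locales (auto simp: arc_to_ends_def)
  then have "verts (contract_arc D e) = {}"
    using assms by (simp add: verts_contract_arc arc_to_ends_def)
  then show "xi_value t x y z (contract_arc D e) 1"
    using assms by (intro xi_value.empty) (auto simp: arcs_contract_arc)
  show "xi_value t x y z (extract_arc D e) 1"
    using assms by (intro xi_value.empty) (auto simp: arcs_extract_arc verts_extract_arc arc_to_ends_def)
  show "xi_value t x y z (pre_digraph.del_arc D e) x"
    using assms by (intro xi_value.single) (auto simp: pre_digraph.del_arc_simps)
qed (use assms in auto)

lemma xi_value_edge:
  assumes "verts D = {u, v}" "u \<noteq> v" "arcs D = {e}" "arc_to_ends D e = (u, v)"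
  shows "xi_value t x y z D (t * x\<^sup>2 + y * x + z)"
proof (rule xi_value_arcI)
  show "fin_digraph D" using assms by unfold_locales (auto simp: arc_to_ends_def)
  then have "verts (contract_arc D e) = {u}"
    using assms by (auto simp add: verts_contract_arc arc_to_ends_def)
  then show "xi_value t x y z (contract_arc D e) x"
    using assms by (intro xi_value.single) (auto simp: arcs_contract_arc)
  show "xi_value t x y z (extract_arc D e) 1"
    using assms by (intro xi_value.empty) (auto simp: arcs_extract_arc verts_extract_arc arc_to_ends_def)
  show "xi_value t x y z (pre_digraph.del_arc D e) (x\<^sup>2)"
    using assms xi_value_arcless[of "pre_digraph.del_arc D e" t x y z]
    by (simp add: pre_digraph.del_arc_simps power2_eq_square)
qed (use assms in auto)

text \<open>Contracting or extracting the loop deletes \<open>u\<close> and with it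
  \<open>f\<close>, whichever way \<open>f\<close> points. Both directions are allowed since both
  occur in the conflicting digraphs.\<close>

lemma xi_value_loop_edge_via_loop:
  assumes "verts D = {u, v}" "u \<noteq> v" "arcs D = {e, f}" "e \<noteq> f"
    "arc_to_ends D e = (u, u)" "arc_to_ends D f = (u, v) \<or> arc_to_ends D f = (v, u)"
  shows "xi_value t x y z D (t * (t * x\<^sup>2 + y * x + z) + y * x + z * x)"
proof (rule xi_value_arcI)
  show fin: "fin_digraph D" using assms by unfold_locales (auto simp: arc_to_ends_def)
  have c: "verts (contract_arc D e) = {v}"
    using assms by (auto simp add: verts_contract_arc[OF fin] arc_to_ends_def)
  then show "xi_value t x y z (contract_arc D e) x"
    using assms by (intro xi_value.single) (auto simp: arcs_contract_arc arc_to_ends_def)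
  have x: "verts (extract_arc D e) = {v}"
    using assms by (auto simp add: verts_extract_arc arc_to_ends_def)
  then show "xi_value t x y z (extract_arc D e) x"
    using assms by (intro xi_value.single) (auto simp: arcs_extract_arc arc_to_ends_def)
  obtain a b where "{a, b} = {u, v}" "a \<noteq> b" "arc_to_ends D f = (a, b)" using assms by blast
  then show "xi_value t x y z (pre_digraph.del_arc D e) (t * x\<^sup>2 + y * x + z)"
    using assms by (intro xi_value_edge[of _ a b f]) (auto simp: pre_digraph.del_arc_simps arc_to_ends_def)
qed (use assms in auto)

text \<open>Deleting \<open>f\<close> leaves a loop and an isolated vertex, while contracting
  \<open>f\<close> kills the loop, which has the same tail.\<close>

lemma xi_value_loop_edge_via_edge:
  assumes "verts D = {u, v}" "u \<noteq> v" "arcs D = {e, f}" "e \<noteq> f"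
    "arc_to_ends D e = (u, u)" "arc_to_ends D f = (u, v)"
  shows "xi_value t x y z D (t * ((t * x + y + z) * x) + y * x + z)"
proof (rule xi_value_arcI)
  show fin: "fin_digraph D" using assms by unfold_locales (auto simp: arc_to_ends_def)
  have c: "verts (contract_arc D f) = {u}"
    using assms by (auto simp add: verts_contract_arc[OF fin] arc_to_ends_def)
  then show "xi_value t x y z (contract_arc D f) x"
    using assms by (intro xi_value.single) (auto simp: arcs_contract_arc arc_to_ends_def)
  show "xi_value t x y z (extract_arc D f) 1"
    using assms by (intro xi_value.empty) (auto simp: arcs_extract_arc verts_extract_arc arc_to_ends_def)
  let ?D1 = "D\<lparr>verts := {u}, arcs := {e}\<rparr>" and ?D2 = "D\<lparr>verts := {v}, arcs := {}\<rparr>"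
  have "xi_value t x y z (Digraph_Component.union ?D1 ?D2) ((t * x + y + z) * x)"
  proof (rule xi_value.disjoint_union)
    show "fin_digraph ?D1" "fin_digraph ?D2"
      using assms by (unfold_locales; auto simp: arc_to_ends_def)+
    show "xi_value t x y z ?D1 (t * x + y + z)"
      using assms by (intro xi_value_loop) (auto simp: arc_to_ends_def)
    show "xi_value t x y z ?D2 x" by (intro xi_value.single) auto
  qed (use assms in \<open>auto simp: compatible_def\<close>)
  moreover have "Digraph_Component.union ?D1 ?D2 = pre_digraph.del_arc D f"
    using assms by (intro pre_digraph.equality) (auto simp: pre_digraph.del_arc_simps)
  ultimately show "xi_value t x y z (pre_digraph.del_arc D f) ((t * x + y + z) * x)" by simp
qed (use assms in auto)

text \<open>Contracting \<open>f\<close> turns the opposite arc \<open>g\<close> into a loop at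
  \<open>u\<close>.\<close>

lemma xi_value_opposite_edges:
  assumes "verts D = {u, v}" "u \<noteq> v" "arcs D = {f, g}" "f \<noteq> g"
    "arc_to_ends D f = (u, v)" "arc_to_ends D g = (v, u)"
  shows "xi_value t x y z D (t * (t * x\<^sup>2 + y * x + z) + y * (t * x + y + z) + z)"
proof (rule xi_value_arcI)
  show fin: "fin_digraph D" using assms by unfold_locales (auto simp: arc_to_ends_def)
  have c: "verts (contract_arc D f) = {u}"
    using assms by (auto simp add: verts_contract_arc[OF fin] arc_to_ends_def)
  then show "xi_value t x y z (contract_arc D f) (t * x + y + z)"
    using assms by (intro xi_value_loop[of _ u g])
      (auto simp: arcs_contract_arc ends_contract_arc arc_to_ends_def[of D])
  show "xi_value t x y z (extract_arc D f) 1"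
    using assms by (intro xi_value.empty) (auto simp: arcs_extract_arc verts_extract_arc arc_to_ends_def)
  show "xi_value t x y z (pre_digraph.del_arc D f) (t * x\<^sup>2 + y * x + z)"
    using assms by (intro xi_value_edge[of _ v u g]) (auto simp: pre_digraph.del_arc_simps arc_to_ends_def)
qed (use assms in auto)

section \<open>Conditions forced by well-definedness\<close>

lemma xi_well_defined_unique:
  "xi_well_defined t x y z \<Longrightarrow> xi_value t x y z D r \<Longrightarrow> xi_value t x y z D s \<Longrightarrow> r = s"
  unfolding xi_well_defined_def using xi_value_fin_digraph by blast

lemma xi_well_defined_loop_edge:
  assumes "xi_well_defined t x y z"
  shows "(t - 1) * (z * (x - 1)) = 0"
proof -
  \<comment> \<open>Arc 0 is a loop at vertex 0, and arc 1 goes from vertex 0 to vertex 1.\<close>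
  define D :: "(nat, nat) pre_digraph" where
    "D = \<lparr>verts = {0, 1}, arcs = {0, 1}, tail = (\<lambda>_. 0), head = (\<lambda>a. a)\<rparr>"
  have D: "verts D = {0, 1}" "arcs D = {0, 1}" "arc_to_ends D 0 = (0, 0)" "arc_to_ends D (Suc 0) = (0, Suc 0)"
    by (auto simp: D_def arc_to_ends_def)
  have "t * (t * x\<^sup>2 + y * x + z) + y * x + z * x = t * ((t * x + y + z) * x) + y * x + z"
    by (rule xi_well_defined_unique[OF assms, where D = D];
        (rule xi_value_loop_edge_via_loop[where e = 0 and f = 1 and u = 0 and v = 1]
          | rule xi_value_loop_edge_via_edge[where e = 0 and f = 1 and u = 0 and v = 1])) (simp_all add: D)
  then show ?thesis by (simp add: algebra_simps power2_eq_square)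
qed

text \<open>The loop with a single arc gives no information when \<open>z = 0\<close>; the opposite
  arc adds a condition on \<open>y\<close>.\<close>

lemma xi_well_defined_loop_opposite_edges:
  assumes "xi_well_defined t x y z"
  shows "(t - 1) * (y * (x - (t * x + y + z)) + z * (x - 1)) = 0"
proof -
  \<comment> \<open>Arc 0 is a loop at vertex 0, arc 1 goes from 0 to 1, and arc 2 from 1 to
    0.\<close>
  define D :: "(nat, nat) pre_digraph" where
    "D = \<lparr>verts = {0, 1}, arcs = {0, 1, 2}, tail = (\<lambda>a. if a = 2 then 1 else 0),
      head = (\<lambda>a. if a = 1 then 1 else 0)\<rparr>"
  have D: "verts D = {0, 1}" "arcs D = {0, 1, 2}" "tail D = (\<lambda>a. if a = 2 then 1 else 0)"
      "head D = (\<lambda>a. if a = 1 then 1 else 0)"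
    by (auto simp: D_def)
  have fin: "fin_digraph D" by unfold_locales (auto simp: D)
  let ?K = "t * x\<^sup>2 + y * x + z" and ?L = "t * x + y + z"
  \<comment> \<open>Arc 1 first: its contraction kills the loop, which shares its tail, and makes a
    new loop of arc 2.\<close>
  have "xi_value t x y z D (t * (t * ?K + y * x + z * x) + y * ?L + z)"
  proof (rule xi_value_arcI[OF fin, where e = 1])
    show "xi_value t x y z (pre_digraph.del_arc D 1) (t * ?K + y * x + z * x)"
      by (rule xi_value_loop_edge_via_loop[where e = 0 and f = 2 and u = 0 and v = 1])
        (auto simp: D pre_digraph.del_arc_simps arc_to_ends_def)
    show "xi_value t x y z (contract_arc D 1) ?L"
      using fin by (intro xi_value_loop[of _ 0 2])
        (auto simp: D verts_contract_arc arcs_contract_arc ends_contract_arc)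
    show "xi_value t x y z (extract_arc D 1) 1"
      by (intro xi_value.empty) (auto simp: D arcs_extract_arc verts_extract_arc)
  qed (auto simp: D)
  \<comment> \<open>Loop first: deletion leaves the 2-cycle, and both other operations leave vertex
    1 isolated. The term \<open>t * t * ?K\<close> is common to both results and cancels.\<close>
  moreover have "xi_value t x y z D (t * (t * ?K + y * ?L + z) + y * x + z * x)"
  proof (rule xi_value_arcI[OF fin, where e = 0])
    show "xi_value t x y z (pre_digraph.del_arc D 0) (t * ?K + y * ?L + z)"
      by (rule xi_value_opposite_edges[where f = 1 and g = 2 and u = 0 and v = 1])
        (auto simp: D pre_digraph.del_arc_simps arc_to_ends_def)
    show "xi_value t x y z (contract_arc D 0) x"
      using fin by (intro xi_value.single[of _ 1]) (auto simp: D verts_contract_arc arcs_contract_arc)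
    show "xi_value t x y z (extract_arc D 0) x"
      by (intro xi_value.single[of _ 1]) (auto simp: D arcs_extract_arc verts_extract_arc)
  qed (auto simp: D)
  ultimately have "t * (t * ?K + y * x + z * x) + y * ?L + z = t * (t * ?K + y * ?L + z) + y * x + z * x"
    by (rule xi_well_defined_unique[OF assms])
  then show ?thesis by (simp add: algebra_simps)
qed

text \<open>If \<open>t \<noteq> 1\<close>, the first condition gives \<open>z = 0\<close> because
  \<open>x \<noteq> 1\<close>. The second then reads \<open>y * (x - (t * x + y)) = 0\<close>, and
  the last assumption excludes the degenerate solution with \<open>y = (1 - t) * x\<close>
  nonzero.\<close>

lemma xi_well_defined_imp:
  fixes t x y z :: "'a::idom"
  assumes "xi_well_defined t x y z" "x \<noteq> 1" "y = 0 \<or> x \<noteq> t * x + y"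
  shows "t = 1 \<or> (y = 0 \<and> z = 0)"
  using xi_well_defined_loop_edge[OF assms(1)] xi_well_defined_loop_opposite_edges[OF assms(1)] assms(2,3)
  by auto

section \<open>Sufficiency and the closed form\<close>

lemma xi_well_defined_t_1: "xi_well_defined 1 x y z"
  unfolding xi_well_defined_def
proof (intro allI impI)
  fix D :: "(nat, nat) pre_digraph" assume "fin_digraph D"
  obtain es where "mset es = ends_mset D" using ex_mset by blast
  then show "\<exists>!r. xi_value 1 x y z D r"
    using xi_value_exists[OF \<open>fin_digraph D\<close>] xi_value_t_1 by metis
qed

lemma xi_well_defined_y_z_0: "xi_well_defined t x 0 0"
  unfolding xi_well_defined_def using xi_value_exists xi_value_y_z_0 by metis

lemma xi_hat_y_z_0:
  assumes "fin_digraph D"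
  shows "xi_hat t x 0 0 D = t ^ card (arcs D) * x ^ card (verts D)"
  unfolding xi_hat_def
  using xi_value_exists[OF assms] xi_value_y_z_0 by (metis the_equality)

theorem theorem4p1:
  fixes t y z :: "'a::idom"
  shows "(xi_well_defined [:t:] [:0, 1:] [:y:] [:z:] \<longleftrightarrow> t = 1 \<or> (y = 0 \<and> z = 0))
    \<and> ((\<forall>x. xi_well_defined t x y z) \<longleftrightarrow> t = 1 \<or> (y = 0 \<and> z = 0))
    \<and> (y = 0 \<and> z = 0 \<longrightarrow> (\<forall>D. fin_digraph D \<longrightarrow>
          xi_hat [:t:] [:0, 1:] [:y:] [:z:] D = [:t:] ^ card (arcs D) * [:0, 1:] ^ card (verts D)
          \<and> (\<forall>x. xi_hat t x y z D = t ^ card (arcs D) * x ^ card (verts D))))"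
proof (intro conjI)
  show "xi_well_defined [:t:] [:0, 1:] [:y:] [:z:] \<longleftrightarrow> t = 1 \<or> (y = 0 \<and> z = 0)"
  proof
    assume "xi_well_defined [:t:] [:0, 1:] [:y:] [:z:]"
    \<comment> \<open>The indeterminate is not 1, and comparing constant coefficients in
      \<open>[:0, 1:] = [:t:] * [:0, 1:] + [:y:]\<close> would give \<open>y = 0\<close>.\<close>
    then have "[:t:] = 1 \<or> ([:y:] = 0 \<and> [:z:] = 0)"
      by (rule xi_well_defined_imp) (auto simp: one_pCons)
    then show "t = 1 \<or> (y = 0 \<and> z = 0)" by (simp add: one_pCons)
  next
    assume "t = 1 \<or> (y = 0 \<and> z = 0)"
    then show "xi_well_defined [:t:] [:0, 1:] [:y:] [:z:]"
      by (auto simp: one_pCons[symmetric] xi_well_defined_t_1 xi_well_defined_y_z_0)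
  qed
  show "(\<forall>x. xi_well_defined t x y z) \<longleftrightarrow> t = 1 \<or> (y = 0 \<and> z = 0)"
    \<comment> \<open>The instance \<open>x = 0\<close> suffices: \<open>0 \<noteq> 1\<close>, and
      \<open>0 = t * 0 + y\<close> holds only for \<open>y = 0\<close>.\<close>
    using xi_well_defined_imp[of t 0 y z]
    by (auto simp: xi_well_defined_t_1 xi_well_defined_y_z_0)
  show "y = 0 \<and> z = 0 \<longrightarrow> (\<forall>D. fin_digraph D \<longrightarrow>
          xi_hat [:t:] [:0, 1:] [:y:] [:z:] D = [:t:] ^ card (arcs D) * [:0, 1:] ^ card (verts D)
          \<and> (\<forall>x. xi_hat t x y z D = t ^ card (arcs D) * x ^ card (verts D)))"
    by (auto simp: xi_hat_y_z_0)
qed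

end
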